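(* $\mathsf{EL}_{K,\Box,B}$ is a sound and complete axiomatization of $\mathcal{L}_{K,\Box,B}$ with respect to the class of all topological subset spaces under epistemic-doxastic (e-d) semantics: for every $\varphi\in\mathcal{L}_{K,\Box,B}$, $\varphi$ is provable in $\mathsf{EL}_{K,\Box,B}$ if and only if $(\mathcal{X},x,U,V)\models\varphi$ for every topological subset model $\mathcal{X}$ and every e-d scenario $(x,U,V)$ of $\mathcal{X}$.
   Context: Language. Fix a countable set PROP of primitive propositions. $\mathcal{L}_{K,\Box,B}$ is generated by $\varphi ::= p \mid \neg\varphi \mid \varphi\wedge\psi \mid K\varphi\mid\Box\varphi\mid B\varphi$, $p\in$ PROP. The connectives $\vee,\to,\leftrightarrow$ are defined as usual. The logic $\mathsf{EL}_{K,\Box,B}$ is the Hilbert system (schemes and rules ranging over formulas of $\mathcal{L}_{K,\Box,B}$) consisting of classical propositional logic (with modus ponens) plus: the $\mathsf{S5}$ principles for $K$: $K(\varphi\to\psi)\to(K\varphi\to K\psi)$, $K\varphi\to\varphi$, $K\varphi\to KK\varphi$, $\neg K\varphi\to K\neg K\varphi$, and the rule "from $\vdash\varphi$ infer $\vdash K\varphi$"; the $\mathsf{S4}$ principles for $\Box$: $\Box(\varphi\to\psi)\to(\Box\varphi\to\Box\psi)$, $\Box\varphi\to\varphi$, $\Box\varphi\to\Box\Box\varphi$, and the rule "from $\vdash\varphi$ infer $\vdash\Box\varphi$"; the schemes $(\mathrm{KI})$ $K\varphi\to\Box\varphi$; $(\mathrm{K}_B)$ $B(\varphi\to\psi)\to(B\varphi\to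 B\psi)$; $(\mathrm{sPI})$ $B\varphi\to KB\varphi$; $(\mathrm{KB})$ $K\varphi\to B\varphi$; $(\mathrm{RB})$ $B\varphi\to B\Box\varphi$. E-d semantics. A topological subset model is a triple $\mathcal{X}=(X,\mathcal{T},v)$ where $X$ is a nonempty set, $\mathcal{T}$ is a topology on $X$, and $v:\mathrm{PROP}\to 2^X$. An e-d scenario of $\mathcal{X}$ is a tuple $(x,U,V)$ with $x\in U$, $U,V\in\mathcal{T}$ and $V\subseteq U$ (neither $x\in V$ nor $V\neq\emptyset$ is required). With $[\![\varphi]\!]^{U,V}=\{y\in U : (\mathcal{X},y,U,V)\models\varphi\}$ and $\mathit{int}$ the interior in $(X,\mathcal{T})$, truth is defined by: $(\mathcal{X},x,U,V)\models p$ iff $x\in v(p)$; the usual clauses for $\neg$ and $\wedge$; $(\mathcal{X},x,U,V)\models K\varphi$ iff $U=[\![\varphi]\!]^{U,V}$; $(\mathcal{X},x,U,V)\models\Box\varphi$ iff $x\in\mathit{int}([\![\varphi]\!]^{U,V})$; $(\mathcal{X},x,U,V)\models B\varphi$ iff $V\subseteq[\![\varphi]\!]^{U,V}$. *)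

theory Defs
  imports "HOL-Analysis.Abstract_Topology" "HOL-Library.Countable"
begin

datatype 'p fm =
    Pro 'p
  | Neg "'p fm" ("\<^bold>\<not> _" [70] 70)
  | Con "'p fm" "'p fm" (infixr "\<^bold>\<and>" 65)
  | Know "'p fm"
  | Box "'p fm"
  | Bel "'p fm"

abbreviation Imp :: "'p fm \<Rightarrow> 'p fm \<Rightarrow> 'p fm" (infixr "\<^bold>\<longrightarrow>" 55) where
  "\<phi> \<^bold>\<longrightarrow> \<psi> \<equiv> \<^bold>\<not> (\<phi> \<^bold>\<and> \<^bold>\<not> \<psi>)"

text \<open>Propositional evaluation relative to an arbitrary assignment \<open>h\<close> of truth values to the
  propositionally atomic formulas, i.e. primitive propositions and formulas of the form
  \<open>Know \<phi>\<close>, \<open>Box \<phi>\<close>, \<open>Bel \<phi>\<close>. The tautologies in this sense are exactly the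
  substitution instances of classical propositional tautologies.\<close>

primrec peval :: "('p fm \<Rightarrow> bool) \<Rightarrow> 'p fm \<Rightarrow> bool" where
  "peval h (Pro p) = h (Pro p)"
| "peval h (\<^bold>\<not> \<phi>) = (\<not> peval h \<phi>)"
| "peval h (\<phi> \<^bold>\<and> \<psi>) = (peval h \<phi> \<and> peval h \<psi>)"
| "peval h (Know \<phi>) = h (Know \<phi>)"
| "peval h (Box \<phi>) = h (Box \<phi>)"
| "peval h (Bel \<phi>) = h (Bel \<phi>)"

definition tautology :: "'p fm \<Rightarrow> bool" where
  "tautology \<phi> \<longleftrightarrow> (\<forall>h. peval h \<phi>)"

inductive EL :: "'p fm \<Rightarrow> bool" ("\<turnstile> _" [50] 50) where
  Taut: "tautology \<phi> \<Longrightarrow> \<turnstile> \<phi>"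
| MP: "\<turnstile> \<phi> \<^bold>\<longrightarrow> \<psi> \<Longrightarrow> \<turnstile> \<phi> \<Longrightarrow> \<turnstile> \<psi>"
| Know_K: "\<turnstile> Know (\<phi> \<^bold>\<longrightarrow> \<psi>) \<^bold>\<longrightarrow> (Know \<phi> \<^bold>\<longrightarrow> Know \<psi>)"
| Know_T: "\<turnstile> Know \<phi> \<^bold>\<longrightarrow> \<phi>"
| Know_4: "\<turnstile> Know \<phi> \<^bold>\<longrightarrow> Know (Know \<phi>)"
| Know_5: "\<turnstile> \<^bold>\<not> Know \<phi> \<^bold>\<longrightarrow> Know (\<^bold>\<not> Know \<phi>)"
| Know_Nec: "\<turnstile> \<phi> \<Longrightarrow> \<turnstile> Know \<phi>"
| Box_K: "\<turnstile> Box (\<phi> \<^bold>\<longrightarrow> \<psi>) \<^bold>\<longrightarrow> (Box \<phi> \<^bold>\<longrightarrow> Box \<psi>)"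
| Box_T: "\<turnstile> Box \<phi> \<^bold>\<longrightarrow> \<phi>"
| Box_4: "\<turnstile> Box \<phi> \<^bold>\<longrightarrow> Box (Box \<phi>)"
| Box_Nec: "\<turnstile> \<phi> \<Longrightarrow> \<turnstile> Box \<phi>"
| KI: "\<turnstile> Know \<phi> \<^bold>\<longrightarrow> Box \<phi>"
| K_B: "\<turnstile> Bel (\<phi> \<^bold>\<longrightarrow> \<psi>) \<^bold>\<longrightarrow> (Bel \<phi> \<^bold>\<longrightarrow> Bel \<psi>)"
| sPI: "\<turnstile> Bel \<phi> \<^bold>\<longrightarrow> Know (Bel \<phi>)"
| KB: "\<turnstile> Know \<phi> \<^bold>\<longrightarrow> Bel \<phi>"
| RB: "\<turnstile> Bel \<phi> \<^bold>\<longrightarrow> Bel (Box \<phi>)"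

text \<open>The underlying set of a model is \<open>topspace T\<close>, which may be any nonempty subset of
  the type of points.\<close>

definition topo_subset_model :: "'a topology \<Rightarrow> ('p \<Rightarrow> 'a set) \<Rightarrow> bool" where
  "topo_subset_model T v \<longleftrightarrow> topspace T \<noteq> {} \<and> (\<forall>p. v p \<subseteq> topspace T)"

definition ed_scenario :: "'a topology \<Rightarrow> 'a \<Rightarrow> 'a set \<Rightarrow> 'a set \<Rightarrow> bool" where
  "ed_scenario T x U V \<longleftrightarrow> x \<in> U \<and> openin T U \<and> openin T V \<and> V \<subseteq> U"

primrec sat :: "'a topology \<Rightarrow> ('p \<Rightarrow> 'a set) \<Rightarrow> 'a \<Rightarrow> 'a set \<Rightarrow> 'a set \<Rightarrow> 'p fm \<Rightarrow> bool" where
  "sat T v x U V (Pro p) \<longleftrightarrow> x \<in> v p"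
| "sat T v x U V (\<^bold>\<not> \<phi>) \<longleftrightarrow> \<not> sat T v x U V \<phi>"
| "sat T v x U V (\<phi> \<^bold>\<and> \<psi>) \<longleftrightarrow> sat T v x U V \<phi> \<and> sat T v x U V \<psi>"
| "sat T v x U V (Know \<phi>) \<longleftrightarrow> U = {y \<in> U. sat T v y U V \<phi>}"
| "sat T v x U V (Box \<phi>) \<longleftrightarrow> x \<in> T interior_of {y \<in> U. sat T v y U V \<phi>}"
| "sat T v x U V (Bel \<phi>) \<longleftrightarrow> V \<subseteq> {y \<in> U. sat T v y U V \<phi>}"

text \<open>Validity in all topological subset models whose points are drawn from the type \<open>'a\<close>.\<close>

definition ed_valid :: "'a itself \<Rightarrow> 'p fm \<Rightarrow> bool" where
  "ed_valid (_ :: 'a itself) \<phi> \<longleftrightarrow>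
    (\<forall>(T :: 'a topology) v x U V.
      topo_subset_model T v \<longrightarrow> ed_scenario T x U V \<longrightarrow> sat T v x U V \<phi>)"

text \<open>HOL cannot quantify over all types inside a formula. Soundness is therefore expressed
  with a free type variable of points, and completeness needs a type with enough
  points: \<open>'p fm set\<close>, with \<open>'p\<close> countable, has the cardinality of the continuum.
  Validity over models of all types implies validity over that one.\<close>

end

theory Submission
  imports Defs
begin

text \<open>Soundness is a routine induction. For completeness, let \<open>\<Gamma>\<close> be a maximal consistent set. The
  model consists of the maximal consistent sets that contain the same formulas \<open>Know \<psi>\<close> as \<open>\<Gamma>\<close>, with
  the Alexandroff topology of the canonical \<open>Box\<close>-successor relation. Take \<open>U\<close> to be the whole space
  and \<open>V\<close> the set of points that contain everything believed in \<open>\<Gamma>\<close>. The scheme \<open>RB\<close> makes \<open>V\<close> open,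
  \<open>KI\<close> keeps \<open>Box\<close>-successors inside the space, and since knowledge is positively and negatively
  introspective, \<open>KB\<close> keeps \<open>V\<close> inside it. Finally \<open>sPI\<close> makes beliefs constant on the space.\<close>

section \<open>Soundness\<close>

text \<open>Truth at a fixed scenario is itself an assignment to the propositionally atomic
  formulas, so it satisfies every tautology.\<close>

lemma peval_sat: "peval (sat T v x U V) \<phi> = sat T v x U V \<phi>"
  by (induction \<phi>) auto

text \<open>\<open>U\<close> and \<open>V\<close> stay fixed while the point varies: the
  necessitation rules need the induction hypothesis at every point of \<open>U\<close>.\<close>

lemma soundness:
  assumes "\<turnstile> \<phi>" "openin T U" "openin T V" "V \<subseteq> U" "x \<in> U"
  shows "sat T v x U V \<phi>"
  using assms(1,5)
proof (induction arbitrary: x rule: EL.induct)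
  case (Taut \<phi>)
  then show ?case by (metis tautology_def peval_sat)
next
  case (Box_K \<phi> \<psi>)
  let ?A = "{y \<in> U. sat T v y U V (\<phi> \<^bold>\<longrightarrow> \<psi>)}" and ?B = "{y \<in> U. sat T v y U V \<phi>}"
  have "T interior_of ?A \<inter> T interior_of ?B = T interior_of (?A \<inter> ?B)"
    by (simp add: interior_of_Int)
  also have "\<dots> \<subseteq> T interior_of {y \<in> U. sat T v y U V \<psi>}"
    by (rule interior_of_mono) auto
  finally show ?case by auto
next
  case (Box_T \<phi>)
  then show ?case using interior_of_subset by fastforce
next
  case (Box_4 \<phi>)
  let ?A = "{y \<in> U. sat T v y U V \<phi>}"
  have "T interior_of ?A \<subseteq> {y \<in> U. y \<in> T interior_of ?A}"
    using interior_of_subset[of T ?A] by auto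
  then have "T interior_of ?A \<subseteq> T interior_of {y \<in> U. y \<in> T interior_of ?A}"
    by (simp add: interior_of_maximal)
  then show ?case by auto
next
  case (Box_Nec \<phi>)
  then have "{y \<in> U. sat T v y U V \<phi>} = U" by auto
  then show ?case using assms(2) Box_Nec.prems by (simp add: interior_of_openin)
next
  case (KI \<phi>)
  then show ?case using assms(2) by (auto simp: interior_of_openin dest: sym)
next
  case (RB \<phi>)
  \<comment> \<open>\<open>V\<close> is open, so once it lies in a truth set it lies in the interior
    of that set.\<close>
  then show ?case using assms(3,4) interior_of_maximal[of V _ T] by auto
qed (use assms(4) in auto)

section \<open>Maximal consistent sets\<close>

text \<open>Closure is under modus ponens only, not under necessitation. Theories stand in for
  derivations from hypotheses.\<close>

definition el_theory :: "'p fm set \<Rightarrow> bool" where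
  "el_theory S \<longleftrightarrow> (\<forall>\<phi>. \<turnstile> \<phi> \<longrightarrow> \<phi> \<in> S) \<and> (\<forall>\<phi> \<psi>. \<phi> \<^bold>\<longrightarrow> \<psi> \<in> S \<longrightarrow> \<phi> \<in> S \<longrightarrow> \<psi> \<in> S)"

definition max_consistent :: "'p fm set \<Rightarrow> bool" where
  "max_consistent S \<longleftrightarrow> el_theory S \<and> (\<forall>\<phi>. \<^bold>\<not> \<phi> \<in> S \<longleftrightarrow> \<phi> \<notin> S)"

lemma el_theory_EL: "el_theory S \<Longrightarrow> \<turnstile> \<phi> \<Longrightarrow> \<phi> \<in> S"
  by (simp add: el_theory_def)

lemma el_theory_MP: "el_theory S \<Longrightarrow> \<phi> \<^bold>\<longrightarrow> \<psi> \<in> S \<Longrightarrow> \<phi> \<in> S \<Longrightarrow> \<psi> \<in> S"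
  unfolding el_theory_def by blast

lemma el_theory_Imp: "el_theory S \<Longrightarrow> \<turnstile> \<phi> \<^bold>\<longrightarrow> \<psi> \<Longrightarrow> \<phi> \<in> S \<Longrightarrow> \<psi> \<in> S"
  by (blast intro: el_theory_MP el_theory_EL)

lemma el_theory_Imp2: "el_theory S \<Longrightarrow> \<turnstile> \<phi> \<^bold>\<longrightarrow> (\<psi> \<^bold>\<longrightarrow> \<chi>) \<Longrightarrow> \<phi> \<in> S \<Longrightarrow> \<psi> \<in> S \<Longrightarrow> \<chi> \<in> S"
  by (blast intro: el_theory_MP el_theory_EL)

text \<open>The deduction theorem in terms of sets: this is the least theory containing
  \<open>S\<close> and \<psi>.\<close>

lemma el_theory_cond:
  assumes "el_theory S"
  shows "el_theory {\<chi>. \<psi> \<^bold>\<longrightarrow> \<chi> \<in> S}"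
proof -
  have "\<turnstile> \<chi> \<^bold>\<longrightarrow> (\<psi> \<^bold>\<longrightarrow> \<chi>)"
    and "\<turnstile> (\<psi> \<^bold>\<longrightarrow> (\<phi> \<^bold>\<longrightarrow> \<chi>)) \<^bold>\<longrightarrow> ((\<psi> \<^bold>\<longrightarrow> \<phi>) \<^bold>\<longrightarrow> (\<psi> \<^bold>\<longrightarrow> \<chi>))" for \<phi> \<chi>
    by (auto intro!: Taut simp: tautology_def)
  with assms show ?thesis
    unfolding el_theory_def[of "Collect _"]
    by (blast intro: el_theory_Imp el_theory_Imp2 el_theory_EL)
qed

text \<open>Zorn's lemma yields a theory maximal among those that extend \<open>S\<close> and omit
  \<phi>. The omitted formula then acts as falsum for \<open>M\<close>.\<close>

lemma lindenbaum:
  assumes "el_theory S" "\<phi> \<notin> S"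
  obtains M where "max_consistent M" "S \<subseteq> M" "\<phi> \<notin> M"
proof -
  let ?A = "{M. el_theory M \<and> S \<subseteq> M \<and> \<phi> \<notin> M}"
  have "\<exists>M\<in>?A. \<forall>N\<in>?A. M \<subseteq> N \<longrightarrow> N = M"
  proof (rule subset_Zorn_nonempty)
    show "?A \<noteq> {}" using assms by auto
  next
    fix C assume C: "C \<noteq> {}" "subset.chain ?A C"
    have "el_theory (\<Union>C)"
      unfolding el_theory_def
    proof (intro conjI allI impI)
      fix \<psi> \<chi> :: "'a fm" assume "\<psi> \<^bold>\<longrightarrow> \<chi> \<in> \<Union>C" "\<psi> \<in> \<Union>C"
      then obtain D E where "D \<in> C" "E \<in> C" "\<psi> \<^bold>\<longrightarrow> \<chi> \<in> D" "\<psi> \<in> E" by blast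
      moreover from this have "D \<subseteq> E \<or> E \<subseteq> D" and "el_theory D" "el_theory E"
        using C(2) by (auto simp: subset_chain_def)
      ultimately show "\<chi> \<in> \<Union>C" by (blast intro: el_theory_MP)
    qed (use C el_theory_EL in \<open>fastforce simp: subset_chain_def\<close>)
    then show "\<Union>C \<in> ?A" using C by (auto simp: subset_chain_def)
  qed
  then obtain M where "M \<in> ?A" and max: "\<forall>N\<in>?A. M \<subseteq> N \<longrightarrow> N = M" ..
  then have M: "el_theory M" "S \<subseteq> M" "\<phi> \<notin> M" by auto
  \<comment> \<open>Otherwise the theory generated by \<open>M\<close> and \<psi> would still omit
    \<phi> and properly extend \<open>M\<close>.\<close>
  have Imp: "\<psi> \<^bold>\<longrightarrow> \<phi> \<in> M" if "\<psi> \<notin> M" for \<psi>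
  proof (rule ccontr)
    let ?N = "{\<chi>. \<psi> \<^bold>\<longrightarrow> \<chi> \<in> M}"
    assume "\<psi> \<^bold>\<longrightarrow> \<phi> \<notin> M"
    moreover have "\<turnstile> \<psi> \<^bold>\<longrightarrow> \<psi>" "\<turnstile> \<chi> \<^bold>\<longrightarrow> (\<psi> \<^bold>\<longrightarrow> \<chi>)" for \<chi>
      by (auto intro!: Taut simp: tautology_def)
    then have "M \<subseteq> ?N" "\<psi> \<in> ?N"
      using M(1) el_theory_Imp by (auto intro: el_theory_EL)
    ultimately have "?N \<in> ?A" "M \<subseteq> ?N"
      using el_theory_cond[OF M(1)] M(2) by auto
    with max have "?N = M" by blast
    with \<open>\<psi> \<in> ?N\<close> that show False by blast
  qed
  have "\<^bold>\<not> \<psi> \<in> M \<longleftrightarrow> \<psi> \<notin> M" for \<psi>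
  proof
    assume "\<^bold>\<not> \<psi> \<in> M"
    moreover have "\<turnstile> \<^bold>\<not> \<psi> \<^bold>\<longrightarrow> (\<psi> \<^bold>\<longrightarrow> \<phi>)"
      by (auto intro!: Taut simp: tautology_def)
    ultimately show "\<psi> \<notin> M" using M el_theory_Imp2 by blast
  next
    assume "\<psi> \<notin> M"
    \<comment> \<open>If the negation of \<psi> were missing as well, \<open>Imp\<close> applied to
      both formulas would put \<phi> into \<open>M\<close>.\<close>
    moreover have "\<turnstile> (\<psi> \<^bold>\<longrightarrow> \<phi>) \<^bold>\<longrightarrow> ((\<^bold>\<not> \<psi> \<^bold>\<longrightarrow> \<phi>) \<^bold>\<longrightarrow> \<phi>)"
      by (auto intro!: Taut simp: tautology_def)
    ultimately show "\<^bold>\<not> \<psi> \<in> M" using M Imp el_theory_Imp2 by blast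
  qed
  with M that show thesis by (auto simp: max_consistent_def)
qed

lemma max_consistent_theory: "max_consistent M \<Longrightarrow> el_theory M"
  by (simp add: max_consistent_def)

lemma max_consistent_Neg: "max_consistent M \<Longrightarrow> \<^bold>\<not> \<phi> \<in> M \<longleftrightarrow> \<phi> \<notin> M"
  by (simp add: max_consistent_def)

lemma max_consistent_Con:
  assumes "max_consistent M"
  shows "\<phi> \<^bold>\<and> \<psi> \<in> M \<longleftrightarrow> \<phi> \<in> M \<and> \<psi> \<in> M"
proof -
  have "\<turnstile> \<phi> \<^bold>\<and> \<psi> \<^bold>\<longrightarrow> \<phi>" "\<turnstile> \<phi> \<^bold>\<and> \<psi> \<^bold>\<longrightarrow> \<psi>" "\<turnstile> \<phi> \<^bold>\<longrightarrow> (\<psi> \<^bold>\<longrightarrow> \<phi> \<^bold>\<and> \<psi>)"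
    by (auto intro!: Taut simp: tautology_def)
  then show ?thesis
    using max_consistent_theory[OF assms] el_theory_Imp el_theory_Imp2 by metis
qed

text \<open>Normality of \<open>F\<close> makes the formulas \<psi> with \<open>F \<psi>\<close> in
  \<open>M\<close> a theory, to which \<open>lindenbaum\<close> applies. A generic \<open>F\<close>
  lets one proof serve \<open>Know\<close>, \<open>Box\<close> and \<open>Bel\<close>.\<close>

lemma max_consistent_witness:
  assumes M: "max_consistent M"
    and K: "\<And>\<phi> \<psi>. \<turnstile> F (\<phi> \<^bold>\<longrightarrow> \<psi>) \<^bold>\<longrightarrow> (F \<phi> \<^bold>\<longrightarrow> F \<psi>)"
    and Nec: "\<And>\<phi>. \<turnstile> \<phi> \<Longrightarrow> \<turnstile> F \<phi>"
    and "F \<phi> \<notin> M"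
  obtains N where "max_consistent N" "\<And>\<psi>. F \<psi> \<in> M \<Longrightarrow> \<psi> \<in> N" "\<phi> \<notin> N"
proof -
  note T = max_consistent_theory[OF M]
  have "el_theory {\<psi>. F \<psi> \<in> M}"
    unfolding el_theory_def using el_theory_Imp2[OF T K] el_theory_EL[OF T Nec] by blast
  then obtain N where "max_consistent N" "{\<psi>. F \<psi> \<in> M} \<subseteq> N" "\<phi> \<notin> N"
    using lindenbaum assms(4) by blast
  with that show thesis by blast
qed

section \<open>The canonical model\<close>

text \<open>The up-sets of \<open>R\<close>, relative to a carrier \<open>X\<close> because the
  model is only a part of its type.\<close>

definition alexandroff :: "'a set \<Rightarrow> ('a \<Rightarrow> 'a \<Rightarrow> bool) \<Rightarrow> 'a topology" where
  "alexandroff X R = topology (\<lambda>S. S \<subseteq> X \<and> (\<forall>y\<in>S. \<forall>z\<in>X. R y z \<longrightarrow> z \<in> S))"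

lemma openin_alexandroff:
  "openin (alexandroff X R) S \<longleftrightarrow> S \<subseteq> X \<and> (\<forall>y\<in>S. \<forall>z\<in>X. R y z \<longrightarrow> z \<in> S)"
proof -
  have "istopology (\<lambda>S. S \<subseteq> X \<and> (\<forall>y\<in>S. \<forall>z\<in>X. R y z \<longrightarrow> z \<in> S))"
    unfolding istopology_def by blast
  then show ?thesis by (simp add: alexandroff_def topology_inverse')
qed

lemma topspace_alexandroff: "topspace (alexandroff X R) = X"
  unfolding topspace_def openin_alexandroff by blast

text \<open>Transitivity makes the cone of successors of \<open>x\<close> open and reflexivity puts
  \<open>x\<close> into it, so it is the least open neighbourhood of \<open>x\<close>. Interior thus
  becomes the Kripke box.\<close>

lemma interior_of_alexandroff:
  assumes "reflp_on X R" "transp_on X R" "A \<subseteq> X" "x \<in> X"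
  shows "x \<in> alexandroff X R interior_of A \<longleftrightarrow> (\<forall>z\<in>X. R x z \<longrightarrow> z \<in> A)"
proof
  assume "x \<in> alexandroff X R interior_of A"
  then show "\<forall>z\<in>X. R x z \<longrightarrow> z \<in> A"
    unfolding interior_of_def openin_alexandroff by blast
next
  assume A: "\<forall>z\<in>X. R x z \<longrightarrow> z \<in> A"
  have "openin (alexandroff X R) {z \<in> X. R x z}"
    unfolding openin_alexandroff using assms(2,4) by (auto dest: transp_onD)
  then show "x \<in> alexandroff X R interior_of A"
    unfolding interior_of_def using A assms(1,4) by (auto dest: reflp_onD)
qed

definition box_rel :: "'p fm set \<Rightarrow> 'p fm set \<Rightarrow> bool" where
  "box_rel y z \<longleftrightarrow> (\<forall>\<phi>. Box \<phi> \<in> y \<longrightarrow> \<phi> \<in> z)"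

text \<open>For maximal consistent \<Gamma>, its equivalence class under the canonical S5 relation;
  as the whole of \<open>U\<close> it turns \<open>Know\<close> into a universal quantifier.\<close>

definition know_class :: "'p fm set \<Rightarrow> 'p fm set set" where
  "know_class \<Gamma> = {z. max_consistent z \<and> (\<forall>\<phi>. Know \<phi> \<in> z \<longleftrightarrow> Know \<phi> \<in> \<Gamma>)}"

definition doxastic_range :: "'p fm set \<Rightarrow> 'p fm set set" where
  "doxastic_range \<Gamma> = {z. max_consistent z \<and> (\<forall>\<phi>. Bel \<phi> \<in> \<Gamma> \<longrightarrow> \<phi> \<in> z)}"

abbreviation canonical_topology :: "'p fm set \<Rightarrow> 'p fm set topology" where
  "canonical_topology \<Gamma> \<equiv> alexandroff (know_class \<Gamma>) box_rel"

abbreviation canonical_valuation :: "'p fm set \<Rightarrow> 'p \<Rightarrow> 'p fm set set" where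
  "canonical_valuation \<Gamma> p \<equiv> {z \<in> know_class \<Gamma>. Pro p \<in> z}"

lemma know_class_theory: "y \<in> know_class \<Gamma> \<Longrightarrow> el_theory y"
  by (simp add: know_class_def max_consistent_def)

text \<open>One inclusion suffices: \<open>Know_4\<close> passes known formulas on to
  \<open>y\<close>, and by \<open>Know_5\<close> an unknown formula is known to be unknown, which
  \<open>y\<close> then contains too.\<close>

lemma know_classI:
  assumes \<Gamma>: "max_consistent \<Gamma>" and y: "max_consistent y"
    and K: "\<And>\<phi>. Know \<phi> \<in> \<Gamma> \<Longrightarrow> \<phi> \<in> y"
  shows "y \<in> know_class \<Gamma>"
proof -
  note T = max_consistent_theory[OF \<Gamma>]
  have "Know \<phi> \<in> y" if "Know \<phi> \<in> \<Gamma>" for \<phi>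
    using that K el_theory_Imp[OF T Know_4] by blast
  moreover have "Know \<phi> \<notin> y" if "Know \<phi> \<notin> \<Gamma>" for \<phi>
    using that K el_theory_Imp[OF T Know_5] max_consistent_Neg \<Gamma> y by blast
  ultimately show ?thesis using y by (auto simp: know_class_def)
qed

lemma doxastic_range_subset:
  assumes "max_consistent \<Gamma>"
  shows "doxastic_range \<Gamma> \<subseteq> know_class \<Gamma>"
  using know_classI[OF assms] el_theory_Imp[OF max_consistent_theory[OF assms] KB]
  unfolding doxastic_range_def by blast

lemma box_rel_know_class:
  assumes "y \<in> know_class \<Gamma>" "max_consistent \<Gamma>" "max_consistent z" "box_rel y z"
  shows "z \<in> know_class \<Gamma>"
proof (rule know_classI[OF assms(2,3)])
  fix \<phi> assume "Know \<phi> \<in> \<Gamma>"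
  then have "Know \<phi> \<in> y" using assms(1) by (simp add: know_class_def)
  then show "\<phi> \<in> z"
    using el_theory_Imp[OF know_class_theory[OF assms(1)] KI] assms(4) by (auto simp: box_rel_def)
qed

text \<open>By \<open>sPI\<close> and \<open>Know_T\<close> a belief is equivalent to knowledge of
  it, and points of the class agree on knowledge. Hence a \<open>V\<close> built from \<Gamma> alone
  is right for every point.\<close>

lemma Bel_know_class:
  assumes "y \<in> know_class \<Gamma>" "max_consistent \<Gamma>"
  shows "Bel \<phi> \<in> y \<longleftrightarrow> Bel \<phi> \<in> \<Gamma>"
proof -
  have "Bel \<phi> \<in> z \<longleftrightarrow> Know (Bel \<phi>) \<in> z" if "el_theory z" for z
    using el_theory_Imp[OF that] sPI Know_T by blast
  then show ?thesis
    using assms know_class_theory max_consistent_theory unfolding know_class_def by blast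
qed

lemma reflp_box_rel: "reflp_on (know_class \<Gamma>) box_rel"
  using el_theory_Imp[OF know_class_theory Box_T] by (auto simp: box_rel_def intro!: reflp_onI)

lemma transp_box_rel: "transp_on (know_class \<Gamma>) box_rel"
  using el_theory_Imp[OF know_class_theory Box_4]
  unfolding box_rel_def by (intro transp_onI) blast

text \<open>If \<open>Bel \<phi>\<close> is in \<Gamma>, then by \<open>RB\<close> every point of
  the range contains \<open>Box \<phi>\<close>, so its successors contain \<phi>.\<close>

lemma openin_doxastic_range:
  assumes "max_consistent \<Gamma>"
  shows "openin (canonical_topology \<Gamma>) (doxastic_range \<Gamma>)"
  unfolding openin_alexandroff
  using doxastic_range_subset[OF assms] el_theory_Imp[OF max_consistent_theory[OF assms] RB]
  by (auto simp: doxastic_range_def box_rel_def know_class_def)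

lemma truth_lemma:
  assumes \<Gamma>: "max_consistent \<Gamma>" and "y \<in> know_class \<Gamma>"
  shows "sat (canonical_topology \<Gamma>) (canonical_valuation \<Gamma>) y (know_class \<Gamma>) (doxastic_range \<Gamma>) \<phi>
    \<longleftrightarrow> \<phi> \<in> y"
  using assms(2)
proof (induction \<phi> arbitrary: y)
  case (Pro p)
  then show ?case by simp
next
  case (Neg \<phi>)
  then show ?case by (simp add: know_class_def max_consistent_Neg)
next
  case (Con \<phi> \<psi>)
  then show ?case by (simp add: know_class_def max_consistent_Con)
next
  case (Know \<phi>)
  have "Know \<phi> \<in> y \<longleftrightarrow> (\<forall>z\<in>know_class \<Gamma>. \<phi> \<in> z)"
  proof
    assume "Know \<phi> \<in> y"
    then have "Know \<phi> \<in> z" if "z \<in> know_class \<Gamma>" for z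
      using Know.prems that by (simp add: know_class_def)
    then show "\<forall>z\<in>know_class \<Gamma>. \<phi> \<in> z"
      using el_theory_Imp[OF know_class_theory Know_T] by blast
  next
    assume all: "\<forall>z\<in>know_class \<Gamma>. \<phi> \<in> z"
    \<comment> \<open>The argument runs at \<Gamma> instead of \<open>y\<close>, so that the witness
      falls directly under \<open>know_classI\<close>.\<close>
    have "Know \<phi> \<in> \<Gamma>"
    proof (rule ccontr)
      assume "Know \<phi> \<notin> \<Gamma>"
      with \<Gamma> obtain z where "max_consistent z" "\<And>\<psi>. Know \<psi> \<in> \<Gamma> \<Longrightarrow> \<psi> \<in> z" "\<phi> \<notin> z"
        using max_consistent_witness Know_K Know_Nec by blast
      then show False using know_classI \<Gamma> all by blast
    qed
    then show "Know \<phi> \<in> y" using Know.prems by (simp add: know_class_def)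
  qed
  then show ?case using Know.IH by auto
next
  case (Box \<phi>)
  have "Box \<phi> \<in> y \<longleftrightarrow> (\<forall>z\<in>know_class \<Gamma>. box_rel y z \<longrightarrow> \<phi> \<in> z)"
  proof
    assume "Box \<phi> \<in> y"
    then show "\<forall>z\<in>know_class \<Gamma>. box_rel y z \<longrightarrow> \<phi> \<in> z" by (simp add: box_rel_def)
  next
    assume all: "\<forall>z\<in>know_class \<Gamma>. box_rel y z \<longrightarrow> \<phi> \<in> z"
    show "Box \<phi> \<in> y"
    proof (rule ccontr)
      assume "Box \<phi> \<notin> y"
      moreover have "max_consistent y" using Box.prems by (simp add: know_class_def)
      ultimately obtain z where "max_consistent z" "\<And>\<psi>. Box \<psi> \<in> y \<Longrightarrow> \<psi> \<in> z" "\<phi> \<notin> z"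
        using max_consistent_witness Box_K Box_Nec by blast
      \<comment> \<open>The witness is a successor of \<open>y\<close>, hence again a point of the
        model.\<close>
      then show False
        using box_rel_know_class[OF Box.prems \<Gamma>] all unfolding box_rel_def by blast
    qed
  qed
  then show ?case
    using Box by (auto simp: interior_of_alexandroff[OF reflp_box_rel transp_box_rel])
next
  case (Bel \<phi>)
  have "Bel \<phi> \<in> \<Gamma> \<longleftrightarrow> (\<forall>z\<in>doxastic_range \<Gamma>. \<phi> \<in> z)"
  proof
    assume "Bel \<phi> \<in> \<Gamma>"
    then show "\<forall>z\<in>doxastic_range \<Gamma>. \<phi> \<in> z" by (simp add: doxastic_range_def)
  next
    assume all: "\<forall>z\<in>doxastic_range \<Gamma>. \<phi> \<in> z"
    show "Bel \<phi> \<in> \<Gamma>"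
    proof (rule ccontr)
      \<comment> \<open>Necessitation for \<open>Bel\<close> is derived, as required for the
        witness.\<close>
      have "\<turnstile> Bel \<psi>" if "\<turnstile> \<psi>" for \<psi> :: "'a fm"
        using MP[OF KB Know_Nec[OF that]] .
      moreover assume "Bel \<phi> \<notin> \<Gamma>"
      ultimately obtain z where "max_consistent z" "\<And>\<psi>. Bel \<psi> \<in> \<Gamma> \<Longrightarrow> \<psi> \<in> z" "\<phi> \<notin> z"
        using max_consistent_witness[OF \<Gamma>] K_B by blast
      then show False using all unfolding doxastic_range_def by blast
    qed
  qed
  then show ?case
    using Bel doxastic_range_subset[OF \<Gamma>] Bel_know_class[OF _ \<Gamma>] by auto
qed

lemma completeness:
  fixes \<phi> :: "'p fm"
  assumes "ed_valid TYPE('p fm set) \<phi>"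
  shows "\<turnstile> \<phi>"
proof (rule ccontr)
  assume "\<not> \<turnstile> \<phi>"
  \<comment> \<open>The theorems form the least theory, and it omits \<phi>.\<close>
  moreover have "el_theory {\<psi> :: 'p fm. \<turnstile> \<psi>}"
    by (auto simp: el_theory_def intro: MP)
  ultimately obtain \<Gamma> where \<Gamma>: "max_consistent \<Gamma>" "\<phi> \<notin> \<Gamma>"
    using lindenbaum by blast
  then have mem: "\<Gamma> \<in> know_class \<Gamma>" by (simp add: know_class_def)
  let ?T = "canonical_topology \<Gamma>" and ?v = "canonical_valuation \<Gamma>"
  have "topo_subset_model ?T ?v"
    using mem by (auto simp: topo_subset_model_def topspace_alexandroff)
  \<comment> \<open>The range is empty if \<Gamma> believes both a formula and its negation; e-d
    scenarios admit an empty \<open>V\<close>.\<close>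
  moreover have "ed_scenario ?T \<Gamma> (know_class \<Gamma>) (doxastic_range \<Gamma>)"
    using mem openin_doxastic_range[OF \<Gamma>(1)] doxastic_range_subset[OF \<Gamma>(1)]
    by (simp add: ed_scenario_def openin_alexandroff)
  ultimately have "sat ?T ?v \<Gamma> (know_class \<Gamma>) (doxastic_range \<Gamma>) \<phi>"
    using assms by (simp add: ed_valid_def)
  then show False using truth_lemma[OF \<Gamma>(1) mem] \<Gamma>(2) by blast
qed

theorem theorem8:
  fixes \<phi> :: "('p :: countable) fm"
  shows "(\<turnstile> \<phi> \<longleftrightarrow> ed_valid TYPE('p fm set) \<phi>) \<and>
         (\<turnstile> \<phi> \<longrightarrow> ed_valid TYPE('a) \<phi>)"
proof (intro conjI iffI impI)
  assume "\<turnstile> \<phi>"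
  then show "ed_valid TYPE('p fm set) \<phi>" and "ed_valid TYPE('a) \<phi>"
    by (auto simp: ed_valid_def ed_scenario_def intro: soundness)
qed (rule completeness)

end
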